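(* Let $y$ be the solution on $[0,0.2]$ of the initial value problem $y'=x^2+\frac{y^2}{4}$, $y(0)=-1$, and let $$y_9(x):=-1+\frac{1}{4}x-\frac{1}{16}x^2+\frac{67}{192}x^3-\frac{35}{768}x^4+\frac{69}{5120}x^5-\frac{77}{15360}x^6+\frac{5317}{1032192}x^7-\frac{2655}{1835008}x^8+\frac{80641}{165150720}x^9.$$ Then for all $x$ in $0\leq x\leq 0.2$, the polynomial $y_9(x)$ approximates $y(x)$ with an error that does not exceed $2$ units in the eleventh decimal place, i.e. $$|y(x)-y_9(x)|\leq 2\cdot 10^{-11}.$$
   Context: In the paper, $y_9$ is presented as the partial sum of degree $9$ of the Maclaurin series of the solution $y$.
   Formalization: The printed coefficients of x^6 to x^9 are not the Maclaurin coefficients, and the bound fails with them (error about 7·10^-8 at x=0.2); the formal y_9 uses the true ones: -239/61440, 26171/5160960, -3267/2293760, 39803/82575360. *)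

theory Defs
  imports "HOL-Analysis.Analysis"
begin

definition solves_ivp :: "(real \<Rightarrow> real) \<Rightarrow> bool" where
  "solves_ivp y \<longleftrightarrow> y 0 = -1 \<and>
     (\<forall>x\<in>{0..0.2}. (y has_real_derivative x^2 + (y x)^2 / 4) (at x within {0..0.2}))"

text \<open>The Maclaurin polynomial of degree 9 of the solution. The coefficients of
  \<open>x^6, \<dots>, x^9\<close> in the published source (\<open>-77/15360\<close>, \<open>5317/1032192\<close>, \<open>-2655/1835008\<close>,
  \<open>80641/165150720\<close>) contain arithmetic errors: they are not the Maclaurin coefficients, and with
  them the error at \<open>x = 0.2\<close> is about \<open>7 * 10^(-8)\<close>, so the stated bound fails.
  Corrected values are used here; \<open>y9_maclaurin\<close> below confirms all ten coefficients.\<close>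

definition y9 :: "real \<Rightarrow> real" where
  "y9 x = -1 + 1/4 * x - 1/16 * x^2 + 67/192 * x^3 - 35/768 * x^4 + 69/5120 * x^5
     - 239/61440 * x^6 + 26171/5160960 * x^7 - 3267/2293760 * x^8 + 39803/82575360 * x^9"

lemma y9_maclaurin:
  fixes Y :: "real fps"
  assumes ode: "fps_deriv Y = fps_X^2 + fps_const (1/4) * Y^2"
    and init: "fps_nth Y 0 = -1"
  shows "y9 x = (\<Sum>n\<le>9. fps_nth Y n * x^n)"
proof -
  have rec: "fps_nth Y (Suc n) =
      ((if n = 2 then 1 else 0) + (\<Sum>i\<le>n. fps_nth Y i * fps_nth Y (n - i)) / 4) / real (Suc n)" for n
  proof -
    have "real (Suc n) * fps_nth Y (Suc n) = fps_nth (fps_deriv Y) n" by simp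
    also have "\<dots> = (if n = 2 then 1 else 0) + (\<Sum>i\<le>n. fps_nth Y i * fps_nth Y (n - i)) / 4"
      unfolding ode power2_eq_square[of Y] fps_add_nth fps_mult_left_const_nth
      by (simp add: fps_mult_nth[of Y] fps_X_power_nth atLeast0AtMost)
    finally show ?thesis by (simp add: field_simps)
  qed
  have c1: "fps_nth Y (Suc 0) = 1/4"
    using rec[of 0] by (simp add: atMost_nat_numeral init)
  have c2: "fps_nth Y 2 = -1/16"
    using rec[of 1] by (simp add: numeral_2_eq_2 init c1)
  have c3: "fps_nth Y 3 = 67/192"
    using rec[of 2] by (simp add: atMost_nat_numeral init c1 c2)
  have c4: "fps_nth Y 4 = -35/768"
    using rec[of 3] by (simp add: atMost_nat_numeral init c1 c2 c3)
  have c5: "fps_nth Y 5 = 69/5120"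
    using rec[of 4] by (simp add: atMost_nat_numeral init c1 c2 c3 c4)
  have c6: "fps_nth Y 6 = -239/61440"
    using rec[of 5] by (simp add: atMost_nat_numeral init c1 c2 c3 c4 c5)
  have c7: "fps_nth Y 7 = 26171/5160960"
    using rec[of 6] by (simp add: atMost_nat_numeral init c1 c2 c3 c4 c5 c6)
  have c8: "fps_nth Y 8 = -3267/2293760"
    using rec[of 7] by (simp add: atMost_nat_numeral init c1 c2 c3 c4 c5 c6 c7)
  have c9: "fps_nth Y 9 = 39803/82575360"
    using rec[of 8] by (simp add: atMost_nat_numeral init c1 c2 c3 c4 c5 c6 c7 c8)
  show ?thesis
    by (simp add: y9_def atMost_nat_numeral init c1 c2 c3 c4 c5 c6 c7 c8 c9)
qed

end

theory Submission
  imports Defs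
begin

text \<open>The polynomial \<^term>\<open>y9\<close> almost solves the differential equation: its residual
  \<open>y9' - x\<^sup>2 - y9\<^sup>2 / 4\<close> is \<open>x\<^sup>9\<close> times a factor that lies between \<open>0\<close> and \<open>16 / 10\<^sup>4\<close> on
  \<open>[0, 0.2]\<close> (\<open>residual_factor_bounds\<close>). Adding \<open>x\<^sup>10 / 5120\<close> raises the residual by about
  \<open>10 / 5120 * x\<^sup>9\<close> and keeps it nonnegative; subtracting the same term makes it nonpositive,
  because \<open>10 / 5120 > 16 / 10\<^sup>4\<close>. The cross term of the square contributes
  \<open>\<minusplus> y9 * x\<^sup>10 / 10240\<close>, which has the favourable sign in both cases since \<^term>\<open>y9\<close> is
  nonpositive there, and the term in \<open>x\<^sup>20\<close> is negligible.
  So \<open>y9 + x\<^sup>10 / 5120\<close> is a supersolution and \<open>y9 - x\<^sup>10 / 5120\<close> a subsolution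
  with the initial value of \<open>y\<close>, and the comparison principle \<open>riccati_comparison\<close> encloses
  \<open>y\<close> between them. On the interval \<open>x\<^sup>10 / 5120\<close> is at most \<open>0.2\<^sup>10 / 5120\<close>, which is exactly
  \<open>2 / 10\<^sup>11\<close>.

  The comparison holds because the difference of a super- and a subsolution satisfies a linear
  differential inequality whose coefficient is continuous, so that multiplying it by an
  integrating factor gives a monotone function.\<close>

text \<open>Multiplying by the integrating factor \<open>exp (- P)\<close>, where \<open>P' = p\<close>, turns the inequality
  \<open>w' \<ge> p w\<close> into the monotonicity of \<open>exp (- P) w\<close>.\<close>

lemma nonneg_of_linear_differential_inequality:
  fixes w w' p :: "real \<Rightarrow> real"
  assumes deriv: "\<And>x. x \<in> {a..b} \<Longrightarrow> (w has_real_derivative w' x) (at x within {a..b})"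
    and ineq: "\<And>x. x \<in> {a..b} \<Longrightarrow> p x * w x \<le> w' x"
    and cont: "continuous_on {a..b} p"
    and init: "0 \<le> w a"
    and t: "t \<in> {a..b}"
  shows "0 \<le> w t"
proof -
  obtain P where P: "\<And>x. x \<in> {a..b} \<Longrightarrow> (P has_real_derivative p x) (at x within {a..b})"
    using antiderivative_continuous[OF cont]
    unfolding has_real_derivative_iff_has_vector_derivative by blast
  define v where "v x = exp (- P x) * w x" for x
  have v: "(v has_real_derivative exp (- P x) * (w' x - p x * w x)) (at x within {a..b})"
    if "x \<in> {a..b}" for x
    unfolding v_def
    by (rule derivative_eq_intros deriv P that refl)+ (simp add: algebra_simps)
  have "v a \<le> v t"
  proof (rule DERIV_nonneg_imp_increasing_open[where f = v])
    fix x assume x: "a < x" "x < t"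
    then have "x \<in> {a..b}" "at x within {a..b} = at x"
      using t by (auto simp: at_within_Icc_at)
    then show "\<exists>d. DERIV v x :> d \<and> 0 \<le> d"
      using v[of x] ineq[of x] by (auto intro!: exI)
  next
    show "continuous_on {a..t} v"
      using t by (intro continuous_on_subset[OF DERIV_continuous_on[of "{a..b}"]]) (auto intro: v)
  qed (use t in auto)
  moreover have "0 \<le> v a"
    using init by (simp add: v_def)
  ultimately have "0 \<le> v t"
    by simp
  then show ?thesis
    by (simp add: v_def zero_le_mult_iff)
qed

text \<open>If \<open>u' - c u\<^sup>2 \<le> v' - c v\<^sup>2\<close>, then the difference \<open>w = v - u\<close> satisfies
  \<open>w' \<ge> c (v + u) w\<close>, which is linear in \<open>w\<close>.\<close>

lemma riccati_comparison:
  fixes u v u' v' :: "real \<Rightarrow> real"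
  assumes u: "\<And>x. x \<in> {a..b} \<Longrightarrow> (u has_real_derivative u' x) (at x within {a..b})"
    and v: "\<And>x. x \<in> {a..b} \<Longrightarrow> (v has_real_derivative v' x) (at x within {a..b})"
    and ineq: "\<And>x. x \<in> {a..b} \<Longrightarrow> u' x - c * (u x)^2 \<le> v' x - c * (v x)^2"
    and init: "u a \<le> v a"
    and t: "t \<in> {a..b}"
  shows "u t \<le> v t"
proof -
  have "0 \<le> v t - u t"
  proof (rule nonneg_of_linear_differential_inequality[where a = a and b = b
        and w = "\<lambda>x. v x - u x" and w' = "\<lambda>x. v' x - u' x"
        and p = "\<lambda>x. c * (v x + u x)"])
    show "((\<lambda>x. v x - u x) has_real_derivative v' x - u' x) (at x within {a..b})"
      if "x \<in> {a..b}" for x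
      using that by (intro DERIV_diff u v)
    show "c * (v x + u x) * (v x - u x) \<le> v' x - u' x" if "x \<in> {a..b}" for x
      using ineq[OF that] by (simp add: algebra_simps power2_eq_square)
    show "continuous_on {a..b} (\<lambda>x. c * (v x + u x))"
      by (intro continuous_intros DERIV_continuous_on[OF u] DERIV_continuous_on[OF v])
  qed (use init t in auto)
  then show ?thesis by simp
qed

definition y9_deriv :: "real \<Rightarrow> real" where
  "y9_deriv x = 1/4 - 1/8 * x + 67/64 * x^2 - 35/192 * x^3 + 69/1024 * x^4
     - 239/10240 * x^5 + 26171/737280 * x^6 - 3267/286720 * x^7 + 39803/9175040 * x^8"

lemma has_real_derivative_y9: "(y9 has_real_derivative y9_deriv x) (at x within S)"
  unfolding y9_def[abs_def] y9_deriv_def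
  by (rule derivative_eq_intros refl)+ simp

text \<open>The residual of a Maclaurin polynomial of degree 9 has no terms below \<open>x\<^sup>9\<close>; this is the
  cofactor of \<open>x\<^sup>9\<close>.\<close>

definition residual_factor :: "real \<Rightarrow> real" where
  "residual_factor x = 28687/18350080 - 22267229/19818086400 * x
     + 4016477/9909043200 * x^2 - 9798679/63417876480 * x^3
     + 1287121/42278584320 * x^4 - 1326115837/106542032486400 * x^5
     + 32309239/7102802165760 * x^6 - 589581007/340934503956480 * x^7
     + 14448489/42090679500800 * x^8 - 1584278809/27274760316518400 * x^9"

lemma y9_residual: "y9_deriv x - (y9 x)^2 / 4 = x^2 + x^9 * residual_factor x"
  unfolding y9_def y9_deriv_def residual_factor_def by (simp add: field_simps) algebra

text \<open>The coefficients alternate in sign and decrease quickly enough for the terms themselves to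
  decrease in absolute value, so that consecutive terms can be paired off.\<close>

lemma residual_factor_bounds:
  assumes "0 \<le> x" "x \<le> 0.2"
  shows "0 \<le> residual_factor x" "residual_factor x \<le> 16/10^4"
proof -
  have nonneg: "0 \<le> x^n" for n
    using assms by simp
  have decr: "5 * x^(n + 1) \<le> x^n" for n
    using assms mult_right_mono[of "5 * x" 1 "x^n"] by auto
  have "5 * x^2 \<le> x"
    using decr[of 1] by (simp add: power2_eq_square)
  note bounds = assms this decr[of 2, simplified] decr[of 3, simplified] decr[of 4, simplified]
    decr[of 5, simplified] decr[of 6, simplified] decr[of 7, simplified] decr[of 8, simplified]
    nonneg[of 2] nonneg[of 3] nonneg[of 4] nonneg[of 5] nonneg[of 6] nonneg[of 7] nonneg[of 8]
    nonneg[of 9]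
  show "0 \<le> residual_factor x"
    unfolding residual_factor_def using bounds by linarith
  have "residual_factor x \<le> 16/10000"
    unfolding residual_factor_def using bounds by linarith
  then show "residual_factor x \<le> 16/10^4"
    by simp
qed

lemma y9_nonpos:
  assumes "0 \<le> x" "x \<le> 0.2"
  shows "y9 x \<le> 0"
proof -
  have "0 \<le> x^n \<and> x^n \<le> 1" for n
    using assms by (simp add: power_le_one)
  with assms this[of 2] this[of 3] this[of 4] this[of 5] this[of 6] this[of 7] this[of 8]
    this[of 9] show ?thesis
    unfolding y9_def by linarith
qed

text \<open>Since \<open>x\<^sup>9\<close> also divides the change of the residual under \<open>y9 + K x\<^sup>10\<close>, being a super- or
  subsolution is decided by the sign of the last factor.\<close>

lemma perturbed_y9_residual:
  "(y9_deriv x + 10 * K * x^9) - (y9 x + K * x^10)^2 / 4 =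
     x^2 + x^9 * (residual_factor x + 10 * K - K * x * y9 x / 2 - K^2 * x^11 / 4)"
proof -
  have "(y9_deriv x + 10 * K * x^9) - (y9 x + K * x^10)^2 / 4 =
      (y9_deriv x - (y9 x)^2 / 4) + x^9 * (10 * K - K * x * y9 x / 2 - K^2 * x^11 / 4)"
    by (simp add: power2_sum power_mult_distrib algebra_simps flip: power_Suc power_add power_mult)
  then show ?thesis
    by (simp add: y9_residual algebra_simps)
qed

lemma has_real_derivative_perturbed_y9:
  "((\<lambda>x. y9 x + K * x^10) has_real_derivative y9_deriv x + 10 * K * x^9) (at x within S)"
  by (rule derivative_eq_intros has_real_derivative_y9 refl)+ simp

lemma y9_plus_supersolution:
  assumes "0 \<le> x" "x \<le> 0.2"
  shows "x^2 \<le> (y9_deriv x + 10 * (1/5120) * x^9) - (y9 x + (1/5120) * x^10)^2 / 4"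
proof -
  have "x * y9 x \<le> 0"
    using assms y9_nonpos by (simp add: mult_nonneg_nonpos)
  moreover have "x^11 \<le> 1"
    using assms by (simp add: power_le_one)
  ultimately have "0 \<le> residual_factor x + 10 * (1/5120) - (1/5120) * x * y9 x / 2
      - (1/5120)^2 * x^11 / 4"
    using residual_factor_bounds(1)[OF assms] by (simp add: power2_eq_square)
  then show ?thesis
    unfolding perturbed_y9_residual using assms by simp
qed

lemma y9_minus_subsolution:
  assumes "0 \<le> x" "x \<le> 0.2"
  shows "(y9_deriv x + 10 * (- 1/5120) * x^9) - (y9 x + (- 1/5120) * x^10)^2 / 4 \<le> x^2"
proof -
  have "x * y9 x \<le> 0"
    using assms y9_nonpos by (simp add: mult_nonneg_nonpos)
  moreover have "0 \<le> x^11"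
    using assms by simp
  ultimately have "residual_factor x + 10 * (- 1/5120) - (- 1/5120) * x * y9 x / 2
      - (- 1/5120)^2 * x^11 / 4 \<le> 0"
    using residual_factor_bounds(2)[OF assms]
    by (simp add: power2_eq_square del: zero_le_power_eq_numeral)
  then show ?thesis
    unfolding perturbed_y9_residual using assms by (simp add: mult_nonneg_nonpos)
qed

theorem theorem3:
  fixes y :: "real \<Rightarrow> real"
  assumes "solves_ivp y"
  shows "\<forall>x\<in>{0..0.2}. \<bar>y x - y9 x\<bar> \<le> 2 * (1/10)^11"
proof
  fix t :: real
  assume t: "t \<in> {0..0.2}"
  have init: "y 0 = - 1" "y9 0 = - 1"
    using assms by (auto simp: solves_ivp_def y9_def)
  have y: "(y has_real_derivative x^2 + (y x)^2 / 4) (at x within {0..0.2})"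
    if "x \<in> {0..0.2}" for x
    using assms that by (simp add: solves_ivp_def)
  have upper: "y t \<le> y9 t + (1/5120) * t^10"
    by (rule riccati_comparison[where c = "1/4", OF y has_real_derivative_perturbed_y9 _ _ t])
      (use y9_plus_supersolution init in auto)
  have lower: "y9 t + (- 1/5120) * t^10 \<le> y t"
    by (rule riccati_comparison[where c = "1/4", OF has_real_derivative_perturbed_y9 y _ _ t])
      (use y9_minus_subsolution init in auto)
  have "t^10 \<le> 0.2^10"
    using t by (intro power_mono) auto
  then have "(1/5120) * t^10 \<le> 2 * (1/10)^11"
    by (simp add: power_divide)
  then show "\<bar>y t - y9 t\<bar> \<le> 2 * (1/10)^11"
    using upper lower by linarith
qed

end
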